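(* Let $E, F, X$ be $n$-dimensional normed spaces. Then $X$ is an intermediate space between $E$ and $F$, i.e. $d(E,F)=d(E,X)\,d(X,F)$, if and only if there exist $\lambda\in[0,1]$ and isometric copies $(\mathbb{R}^n,B_E)$, $(\mathbb{R}^n,B_F)$, $(\mathbb{R}^n,B_X)$ of $E$, $F$, $X$ respectively such that $d(E,X)=d(E,F)^\lambda$, $B_E\subset B_F\subset d(E,F)\,B_E$, and $C_\lambda\subset B_X\subset B_\lambda$, where $$B_\lambda=\bigl(d(E,F)^\lambda B_E\bigr)\cap B_F,\qquad C_\lambda=\mathrm{Conv}\Bigl[B_E\cup \tfrac{1}{d(E,F)^{1-\lambda}}B_F\Bigr].$$
   Context: All normed spaces are real. For $n$-dimensional normed spaces $E,F$, the (multiplicative) Banach-Mazur distance is $d(E,F)=\inf\{\|T\|\,\|T^{-1}\| : T:E\to F \text{ is an isomorphism}\}$. A normed space written $(\mathbb{R}^n,B)$ is $\mathbb{R}^n$ with the norm whose closed unit ball is the symmetric convex body $B$. $\mathrm{Conv}(S)$ is the convex hull of $S$. *)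

theory Defs
  imports "HOL-Analysis.Analysis"
begin

definition isomorphism :: "('a::real_normed_vector \<Rightarrow> 'b::real_normed_vector) \<Rightarrow> bool"
  where "isomorphism T \<longleftrightarrow> bounded_linear T \<and> bij T \<and> bounded_linear (inv T)"

text \<open>The value is meaningful only for isomorphic spaces (here: of equal finite dimension);
  otherwise the infimum ranges over the empty set.\<close>

definition banach_mazur :: "'a::real_normed_vector itself \<Rightarrow> 'b::real_normed_vector itself \<Rightarrow> real"
  where "banach_mazur E F = Inf {onorm T * onorm (inv T) | T :: 'a \<Rightarrow> 'b. isomorphism T}"

definition intermediate_space ::
    "'a::real_normed_vector itself \<Rightarrow> 'b::real_normed_vector itself \<Rightarrow>
     'c::real_normed_vector itself \<Rightarrow> bool"
  where "intermediate_space E F X \<longleftrightarrow>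
    banach_mazur E F = banach_mazur E X * banach_mazur X F"

definition symmetric_convex_body :: "'a::euclidean_space set \<Rightarrow> bool"
  where "symmetric_convex_body B \<longleftrightarrow>
    convex B \<and> compact B \<and> interior B \<noteq> {} \<and> (\<forall>x\<in>B. - x \<in> B)"

definition is_norm :: "('a::real_vector \<Rightarrow> real) \<Rightarrow> bool"
  where "is_norm N \<longleftrightarrow>
    (\<forall>x. N x = 0 \<longleftrightarrow> x = 0) \<and>
    (\<forall>x y. N (x + y) \<le> N x + N y) \<and>
    (\<forall>c x. N (c *\<^sub>R x) = \<bar>c\<bar> * N x)"

text \<open>\<open>isometric_copy E B\<close>: the vector space \<open>\<real>\<^sup>n\<close>, equipped with the norm \<open>N\<close> whose closed unit
  ball is \<open>B\<close> (and not with the Euclidean norm of the type), is linearly isometric to \<open>E\<close>.\<close>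

definition isometric_copy :: "'a::real_normed_vector itself \<Rightarrow> (real ^ 'n) set \<Rightarrow> bool"
  where "isometric_copy E B \<longleftrightarrow> symmetric_convex_body B \<and>
    (\<exists>N. is_norm N \<and> {x. N x \<le> 1} = B \<and>
      (\<exists>T :: 'a \<Rightarrow> real ^ 'n. linear T \<and> bij T \<and> (\<forall>x. N (T x) = norm x)))"

definition upper_body :: "real \<Rightarrow> real \<Rightarrow> 'a::real_vector set \<Rightarrow> 'a set \<Rightarrow> 'a set"
  where "upper_body d l BE BF = ((*\<^sub>R) (d powr l) ` BE) \<inter> BF"

definition lower_body :: "real \<Rightarrow> real \<Rightarrow> 'a::real_vector set \<Rightarrow> 'a set \<Rightarrow> 'a set"
  where "lower_body d l BE BF = convex hull (BE \<union> (*\<^sub>R) (1 / d powr (1 - l)) ` BF)"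

end

theory Submission
  imports Defs
begin

text \<open>The Banach--Mazur distance between finite-dimensional spaces is attained. If \<open>X\<close> is
  intermediate, optimal maps \<open>E \<rightarrow> X\<close> and \<open>X \<rightarrow> F\<close>, normalised to have norm \<open>1\<close>, compose to an optimal
  map \<open>E \<rightarrow> F\<close>; pulling the norms of \<open>X\<close> and \<open>F\<close> back along them to the space \<open>E = \<real>\<^sup>n\<close> gives unit
  balls with all the required inclusions. Conversely, the inclusions bound \<open>d(X,F)\<close> by
  \<open>d(E,F)\<close> to the power \<open>1 - \<lambda>\<close>, and equality follows from submultiplicativity.\<close>

subsection \<open>Linear maps between finite-dimensional normed spaces\<close>

lemma linear_inv_if_bij:
  fixes f :: "'a::real_vector \<Rightarrow> 'b::real_vector"
  assumes "linear f" "bij f"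
  shows "linear (inv f)"
  using bij_module_hom_imp_inv_module_hom[of scaleR scaleR f] assms
  unfolding module_hom_iff_linear linear_def by blast

text \<open>A basis of the space has as many elements as the standard basis of
  \<open>real ^ 'n\<close>, and a linear map that carries one basis bijectively to the other is
  bijective.\<close>

lemma obtain_coordinates:
  assumes "dim (UNIV :: 'e::real_normed_vector set) = CARD('n::finite)"
  obtains f :: "real ^ 'n::finite \<Rightarrow> 'e::real_normed_vector" where "linear f" "bij f"
proof -
  obtain B :: "'e set" where B: "independent B" "UNIV \<subseteq> span B" "card B = CARD('n)"
    using real_vector.basis_exists[of "UNIV :: 'e set"] assms by metis
  \<comment> \<open>An infinite set has \<open>card\<close> 0, whereas \<open>CARD('n)\<close> is
    positive; so the dimension hypothesis does force finite dimension.\<close>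
  have "finite B"
    using B(3) by (metis card_ge_0_finite zero_less_card_finite)
  then obtain g where g: "bij_betw g (Basis :: (real ^ 'n) set) B"
    using B(3) finite_same_card_bij[of "Basis :: (real ^ 'n) set" B] by auto
  obtain f :: "real ^ 'n \<Rightarrow> 'e" where f: "linear f" "\<And>x. x \<in> Basis \<Longrightarrow> f x = g x"
    using linear_independent_extend[OF independent_Basis, of g] by auto
  have im: "f ` Basis = B"
    using f(2) g by (auto simp: bij_betw_def image_iff)
  have "inj_on f (span Basis)"
  proof (rule linear_inj_on_span_independent_image[OF f(1)])
    show "independent (f ` Basis)" using im B(1) by simp
    show "inj_on f Basis" using g f(2) by (simp add: bij_betw_def inj_on_def)
  qed
  moreover have "f ` span Basis = span B"
    using linear_span_image[OF f(1), of Basis] im by simp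
  ultimately have "bij f"
    using B(2) by (auto simp: bij_def)
  with f(1) show thesis using that by blast
qed

lemma obtain_nonzero:
  assumes "dim (UNIV :: 'e::real_normed_vector set) = CARD('n::finite)"
  obtains w :: "'e::real_normed_vector" where "w \<noteq> 0"
proof -
  obtain p :: "real ^ 'n \<Rightarrow> 'e" where p: "linear p" "bij p"
    using obtain_coordinates[OF assms] by blast
  have "p (axis undefined 1) \<noteq> p 0"
    using p(2) by (simp add: bij_is_inj inj_eq axis_eq_0_iff)
  then show thesis
    using that by (simp add: linear_0[OF p(1)])
qed

text \<open>By compactness \<open>norm (f x)\<close> attains its minimum on the unit sphere;
  injectivity makes this minimum positive, and homogeneity carries the bound to all vectors.\<close>

lemma linear_inj_bounded_below:
  fixes f :: "'a::euclidean_space \<Rightarrow> 'b::real_normed_vector"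
  assumes f: "linear f" "inj f"
  obtains k where "k > 0" "\<And>x. k * norm x \<le> norm (f x)"
proof -
  have bl: "bounded_linear f"
    using f(1) linear_conv_bounded_linear by blast
  have "continuous_on (sphere 0 1) (\<lambda>x. norm (f x))"
    by (intro continuous_intros linear_continuous_on bl)
  moreover have "sphere (0::'a) 1 \<noteq> {}"
    by simp
  ultimately obtain u where u: "u \<in> sphere (0::'a) 1" "\<And>x. x \<in> sphere 0 1 \<Longrightarrow> norm (f u) \<le> norm (f x)"
    using continuous_attains_inf[OF compact_sphere] by metis
  have "norm (f u) > 0"
    using u(1) f by (auto simp: linear_injective_0)
  moreover have "norm (f u) * norm x \<le> norm (f x)" for x
  proof (cases "x = 0")
    case False
    then have "norm (f u) \<le> norm (f (x /\<^sub>R norm x))"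
      by (intro u(2)) simp
    also have "\<dots> = norm (f x) / norm x"
      by (simp add: linear_scale[OF f(1)] divide_inverse mult.commute)
    finally show ?thesis
      using False by (simp add: field_simps)
  qed (simp add: linear_0[OF f(1)])
  ultimately show thesis using that by blast
qed

text \<open>Factor \<open>f\<close> as \<open>(f \<circ> p) \<circ> inv p\<close>. The first map to
  the left has a Euclidean domain and is therefore bounded; the lower bound for \<open>p\<close> is
  an upper bound for \<open>inv p\<close>.\<close>

lemma bounded_linear_if_linear_finite_dim:
  fixes f :: "'e::real_normed_vector \<Rightarrow> 'f::real_normed_vector"
  assumes dim: "dim (UNIV :: 'e set) = CARD('n::finite)" and f: "linear f"
  shows "bounded_linear f"
proof -
  obtain p :: "real ^ 'n \<Rightarrow> 'e" where p: "linear p" "bij p"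
    using obtain_coordinates[OF dim] by blast
  obtain k where k: "k > 0" "\<And>x. k * norm x \<le> norm (p x)"
    using linear_inj_bounded_below p bij_is_inj by blast
  have "bounded_linear (f \<circ> p)"
    using linear_compose[OF p(1) f] linear_conv_bounded_linear by blast
  moreover have "bounded_linear (inv p)"
  proof -
    have "norm (inv p x) \<le> norm x * (1 / k)" for x
      using k(2)[of "inv p x"] k(1) p(2) by (simp add: bij_is_surj surj_f_inv_f field_simps)
    then show ?thesis
      using linear_inv_if_bij[OF p] unfolding bounded_linear_def bounded_linear_axioms_def by blast
  qed
  ultimately have "bounded_linear (\<lambda>x. (f \<circ> p) (inv p x))"
    by (rule bounded_linear_compose)
  then show ?thesis
    using p(2) by (simp add: bij_is_surj surj_f_inv_f)
qed

subsection \<open>The Banach--Mazur distance\<close>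

text \<open>The constant \<open>c\<close> bounds the norm of \<open>inv T\<close>, so
  \<open>T\<close> is a competitor in the infimum with value at most \<open>b * c\<close>. Stated
  with pointwise inequalities, the bound applies without computing operator norms.\<close>

lemma banach_mazur_le:
  fixes T :: "'e::real_normed_vector \<Rightarrow> 'f::real_normed_vector"
  assumes T: "linear T" "bij T"
    and le: "\<And>x. norm (T x) \<le> b * norm x" "\<And>x. norm x \<le> c * norm (T x)"
    and nn: "b \<ge> 0" "c \<ge> 0"
  shows "banach_mazur TYPE('e) TYPE('f) \<le> b * c"
proof -
  have inv_le: "norm (inv T y) \<le> c * norm y" for y
    using le(2)[of "inv T y"] T(2) by (simp add: bij_is_surj surj_f_inv_f)
  have bl: "bounded_linear T" "bounded_linear (inv T)"
    using le(1) inv_le T(1) linear_inv_if_bij[OF T]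
    by (auto simp: bounded_linear_def bounded_linear_axioms_def mult.commute)
  have "banach_mazur TYPE('e) TYPE('f) \<le> onorm T * onorm (inv T)"
    unfolding banach_mazur_def
  proof (rule cInf_lower)
    show "bdd_below {onorm T * onorm (inv T) | T :: 'e \<Rightarrow> 'f. isomorphism T}"
      by (rule bdd_belowI[of _ 0]) (auto simp: isomorphism_def onorm_pos_le)
  qed (use bl T(2) in \<open>auto simp: isomorphism_def\<close>)
  also have "\<dots> \<le> b * c"
    using nn by (intro mult_mono onorm_pos_le bl onorm_bound[OF nn(1) le(1)] onorm_bound[OF nn(2) inv_le])
  finally show ?thesis .
qed

text \<open>A near-minimiser is divided by its norm. This leaves the product of the two norms
  unchanged and puts all the distortion into the lower estimate.\<close>

lemma banach_mazur_approx:
  assumes dimE: "dim (UNIV :: 'e::real_normed_vector set) = CARD('n::finite)"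
    and dimF: "dim (UNIV :: 'f::real_normed_vector set) = CARD('n)"
    and c: "banach_mazur TYPE('e) TYPE('f) < c"
  obtains T :: "'e::real_normed_vector \<Rightarrow> 'f::real_normed_vector" where "linear T" "\<And>x. norm (T x) \<le> norm x" "\<And>x. norm x \<le> c * norm (T x)"
proof -
  obtain p :: "real ^ 'n \<Rightarrow> 'e" where p: "linear p" "bij p"
    using obtain_coordinates[OF dimE] by blast
  obtain q :: "real ^ 'n \<Rightarrow> 'f" where q: "linear q" "bij q"
    using obtain_coordinates[OF dimF] by blast
  \<comment> \<open>Passing through coordinates gives an isomorphism, so the infimum ranges over a
    nonempty set and can be approximated.\<close>
  have lin: "linear (q \<circ> inv p)" and bij: "bij (q \<circ> inv p)"
    using p q by (auto intro: linear_compose linear_inv_if_bij bij_comp bij_imp_bij_inv)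
  then have "isomorphism (q \<circ> inv p)"
    by (auto simp: isomorphism_def intro!: bounded_linear_if_linear_finite_dim[OF dimE]
        bounded_linear_if_linear_finite_dim[OF dimF] linear_inv_if_bij)
  then have "{onorm T * onorm (inv T) | T :: 'e \<Rightarrow> 'f. isomorphism T} \<noteq> {}"
    by blast
  from cInf_lessD[OF this c[unfolded banach_mazur_def]]
  obtain S :: "'e \<Rightarrow> 'f" where S: "isomorphism S" "onorm S * onorm (inv S) < c"
    by blast
  have blS: "bounded_linear S" and bijS: "bij S" and blS': "bounded_linear (inv S)"
    using S(1) by (auto simp: isomorphism_def)
  obtain w :: 'e where "w \<noteq> 0"
    using obtain_nonzero[OF dimE] .
  then have "S w \<noteq> 0"
    using linear_injective_0[OF bounded_linear.linear[OF blS]] bijS by (auto simp: bij_is_inj)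
  then have pos: "onorm S > 0"
    using onorm_pos_lt[OF blS] by auto
  show thesis
  proof (rule that[of "\<lambda>x. S x /\<^sub>R onorm S"])
    show "linear (\<lambda>x. S x /\<^sub>R onorm S)"
      by (intro linear_compose_scale_right bounded_linear.linear blS)
    show "norm (S x /\<^sub>R onorm S) \<le> norm x" for x
      using onorm[OF blS, of x] pos by (simp add: field_simps)
    show "norm x \<le> c * norm (S x /\<^sub>R onorm S)" for x
    proof -
      have "norm x \<le> onorm (inv S) * norm (S x)"
        using onorm[OF blS', of "S x"] bijS by (simp add: bij_is_inj)
      also have "\<dots> = (onorm S * onorm (inv S)) * norm (S x /\<^sub>R onorm S)"
        using pos by simp
      also have "\<dots> \<le> c * norm (S x /\<^sub>R onorm S)"
        using S(2) by (intro mult_right_mono) auto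
      finally show ?thesis .
    qed
  qed
qed

text \<open>Normalised near-optimal maps form, in coordinates, a bounded sequence
  in a finite-dimensional operator space.\<close>

lemma banach_mazur_attained:
  assumes dimE: "dim (UNIV :: 'e::real_normed_vector set) = CARD('n::finite)"
    and dimF: "dim (UNIV :: 'f::real_normed_vector set) = CARD('n)"
  obtains T :: "'e::real_normed_vector \<Rightarrow> 'f::real_normed_vector" where "linear T" "bij T" "\<And>x. norm (T x) \<le> norm x"
    "\<And>x. norm x \<le> banach_mazur TYPE('e) TYPE('f) * norm (T x)"
proof -
  let ?d = "banach_mazur TYPE('e) TYPE('f)"
  obtain p :: "real ^ 'n \<Rightarrow> 'e" where p: "linear p" "bij p"
    using obtain_coordinates[OF dimE] by blast
  obtain q :: "real ^ 'n \<Rightarrow> 'f" where q: "linear q" "bij q"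
    using obtain_coordinates[OF dimF] by blast
  have pinv: "p (inv p x) = x" "inv p (p y) = y" for x y
    using p(2) by (auto simp: bij_is_surj surj_f_inv_f bij_is_inj)
  have qinv: "q (inv q x) = x" "inv q (q y) = y" for x y
    using q(2) by (auto simp: bij_is_surj surj_f_inv_f bij_is_inj)
  have blp: "bounded_linear p" and blq: "bounded_linear q"
    using p q linear_conv_bounded_linear by blast+
  have blq': "bounded_linear (inv q)"
    using bounded_linear_if_linear_finite_dim[OF dimF] linear_inv_if_bij[OF q] by blast
  have linp': "linear (inv p)"
    using linear_inv_if_bij[OF p] .
  have "\<exists>T :: 'e \<Rightarrow> 'f. linear T \<and> (\<forall>x. norm (T x) \<le> norm x) \<and>
      (\<forall>x. norm x \<le> (?d + inverse (real (Suc m))) * norm (T x))" for m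
    using banach_mazur_approx[OF dimE dimF, of "?d + inverse (real (Suc m))"]
    by (metis inverse_positive_iff_positive less_add_same_cancel1 of_nat_0_less_iff zero_less_Suc)
  then obtain T :: "nat \<Rightarrow> 'e \<Rightarrow> 'f" where T: "\<And>m. linear (T m)" "\<And>m x. norm (T m x) \<le> norm x"
      "\<And>m x. norm x \<le> (?d + inverse (real (Suc m))) * norm (T m x)"
    by metis
  \<comment> \<open>In coordinates the operators lie in
    \<open>real ^ 'n \<Rightarrow>\<^sub>L real ^ 'n\<close>, where bounded sequences have
    convergent subsequences.\<close>
  define G where "G m = Blinfun (\<lambda>x. inv q (T m (p x)))" for m
  have G: "blinfun_apply (G m) x = inv q (T m (p x))" for m x
  proof -
    have "linear (inv q \<circ> (T m \<circ> p))"
      by (intro linear_compose p(1) T(1) bounded_linear.linear blq')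
    then have "bounded_linear (\<lambda>x. inv q (T m (p x)))"
      using linear_conv_bounded_linear by (auto simp: o_def)
    then show ?thesis
      by (simp add: G_def bounded_linear_Blinfun_apply)
  qed
  have "norm (G m) \<le> onorm (inv q) * onorm p" for m
  proof (rule norm_blinfun_bound)
    show "0 \<le> onorm (inv q) * onorm p"
      by (simp add: onorm_pos_le blq' blp)
    show "norm (G m x) \<le> onorm (inv q) * onorm p * norm x" for x
    proof -
      have "norm (G m x) \<le> onorm (inv q) * norm (T m (p x))"
        by (simp add: G onorm[OF blq'])
      also have "\<dots> \<le> onorm (inv q) * (onorm p * norm x)"
        using order_trans[OF T(2) onorm[OF blp]] by (intro mult_left_mono onorm_pos_le blq')
      finally show ?thesis by (simp add: mult.assoc)
    qed
  qed
  then have "bounded (range G)"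
    unfolding bounded_iff by blast
  then obtain L r where r: "strict_mono (r :: nat \<Rightarrow> nat)" and L: "(G \<circ> r) \<longlonglongrightarrow> L"
    using bounded_imp_convergent_subsequence by blast
  define T' where "T' = q \<circ> (blinfun_apply L \<circ> inv p)"
  have lin: "linear T'"
    unfolding T'_def
    by (intro linear_compose q(1) linp' bounded_linear.linear blinfun.bounded_linear_right)
  have lim: "(\<lambda>m. T (r m) x) \<longlonglongrightarrow> T' x" for x
  proof -
    have "(\<lambda>m. q (blinfun_apply ((G \<circ> r) m) (inv p x))) \<longlonglongrightarrow> q (blinfun_apply L (inv p x))"
      by (intro bounded_linear.tendsto[OF blq] bounded_linear.tendsto[OF blinfun.bounded_linear_left] L)
    then show ?thesis
      by (simp add: G qinv pinv T'_def)
  qed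
  have up: "norm (T' x) \<le> norm x" for x
    by (rule LIMSEQ_le_const2[OF tendsto_norm[OF lim[of x]]]) (use T(2) in auto)
  \<comment> \<open>The error term \<open>inverse (real (Suc (r m)))\<close> vanishes in the limit,
    leaving exactly the distance as constant.\<close>
  have low: "norm x \<le> ?d * norm (T' x)" for x
  proof (rule LIMSEQ_le_const)
    have "(\<lambda>m. inverse (real (Suc (r m)))) \<longlonglongrightarrow> 0"
      using LIMSEQ_subseq_LIMSEQ[OF LIMSEQ_inverse_real_of_nat r] by (simp add: o_def)
    then have "(\<lambda>m. (?d + inverse (real (Suc (r m)))) * norm (T (r m) x)) \<longlonglongrightarrow> (?d + 0) * norm (T' x)"
      by (intro tendsto_mult tendsto_add tendsto_const tendsto_norm lim)
    then show "(\<lambda>m. (?d + inverse (real (Suc (r m)))) * norm (T (r m) x)) \<longlonglongrightarrow> ?d * norm (T' x)"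
      by simp
  qed (use T(3) in auto)
  \<comment> \<open>The lower estimate gives a trivial kernel. Surjectivity then comes from the
    coordinate version \<open>L\<close>, an injective endomorphism of
    \<open>real ^ 'n\<close>.\<close>
  have inj: "inj T'"
    using low unfolding linear_injective_0[OF lin] by (metis mult_zero_right norm_le_zero_iff norm_zero)
  have "blinfun_apply L x = inv q (T' (p x))" for x
    by (simp add: T'_def pinv qinv)
  then have "inj (blinfun_apply L)"
    using inj p(2) q(2) by (simp add: inj_def bij_def) (metis qinv(1))
  then have "bij (blinfun_apply L)"
    using linear_inj_imp_surj[of "blinfun_apply L"]
    by (simp add: bij_def bounded_linear.linear blinfun.bounded_linear_right)
  then have "bij T'"
    unfolding T'_def using p(2) q(2) by (intro bij_comp bij_imp_bij_inv)
  with lin up low show thesis using that by blast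
qed

text \<open>An optimal map satisfies \<open>norm w \<le> ?d * norm (T w) \<le> ?d * norm w\<close>;
  a nonzero \<open>w\<close> can be cancelled.\<close>

lemma banach_mazur_ge_1:
  assumes dimE: "dim (UNIV :: 'e::real_normed_vector set) = CARD('n::finite)"
    and dimF: "dim (UNIV :: 'f::real_normed_vector set) = CARD('n)"
  shows "banach_mazur TYPE('e) TYPE('f) \<ge> 1"
proof -
  let ?d = "banach_mazur TYPE('e) TYPE('f)"
  obtain T :: "'e \<Rightarrow> 'f" where T: "\<And>x. norm (T x) \<le> norm x" "\<And>x. norm x \<le> ?d * norm (T x)"
    using banach_mazur_attained[OF dimE dimF] by metis
  obtain w :: 'e where "w \<noteq> 0"
    using obtain_nonzero[OF dimE] .
  then have w: "norm w > 0" by simp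
  \<comment> \<open>The sign must be known before the contraction estimate can be multiplied by
    \<open>?d\<close>.\<close>
  have "?d > 0"
    using less_le_trans[OF w T(2)] by (simp add: zero_less_mult_iff)
  then have "norm w \<le> ?d * norm w"
    using order_trans[OF T(2) mult_left_mono[OF T(1)]] by simp
  then show ?thesis using w by simp
qed

text \<open>The composite of two optimal normalised maps is again a contraction, and its lower
  constants multiply.\<close>

lemma banach_mazur_triangle:
  assumes dimE: "dim (UNIV :: 'e::real_normed_vector set) = CARD('n::finite)"
    and dimF: "dim (UNIV :: 'f::real_normed_vector set) = CARD('n)"
    and dimX: "dim (UNIV :: 'x::real_normed_vector set) = CARD('n)"
  shows "banach_mazur TYPE('e) TYPE('f) \<le> banach_mazur TYPE('e) TYPE('x) * banach_mazur TYPE('x) TYPE('f)"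
proof -
  let ?a = "banach_mazur TYPE('e) TYPE('x)" and ?b = "banach_mazur TYPE('x) TYPE('f)"
  have ab: "?a \<ge> 1" "?b \<ge> 1"
    using banach_mazur_ge_1 dimE dimF dimX by blast+
  obtain S :: "'e \<Rightarrow> 'x" where S: "linear S" "bij S" "\<And>x. norm (S x) \<le> norm x" "\<And>x. norm x \<le> ?a * norm (S x)"
    using banach_mazur_attained[OF dimE dimX] by metis
  obtain T :: "'x \<Rightarrow> 'f" where T: "linear T" "bij T" "\<And>x. norm (T x) \<le> norm x" "\<And>x. norm x \<le> ?b * norm (T x)"
    using banach_mazur_attained[OF dimX dimF] by metis
  have "banach_mazur TYPE('e) TYPE('f) \<le> 1 * (?a * ?b)"
  proof (rule banach_mazur_le[of "T \<circ> S"])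
    show "norm ((T \<circ> S) x) \<le> 1 * norm x" for x
      using order_trans[OF T(3) S(3)] by simp
    show "norm x \<le> ?a * ?b * norm ((T \<circ> S) x)" for x
      using order_trans[OF S(4) mult_left_mono[OF T(4), of ?a "S x"]] ab by (simp add: mult.assoc)
  qed (use S T ab in \<open>auto intro: linear_compose bij_comp\<close>)
  then show ?thesis by simp
qed

subsection \<open>Isometric copies as unit balls of pulled-back norms\<close>

text \<open>The set is the preimage of the closed unit ball: the lower bound for \<open>f\<close>
  makes it bounded, and the preimage of the open ball gives interior points.\<close>

lemma symmetric_convex_body_pullback:
  fixes f :: "'a::euclidean_space \<Rightarrow> 'b::real_normed_vector"
  assumes f: "linear f" "inj f"
  shows "symmetric_convex_body {x. norm (f x) \<le> 1}"
  unfolding symmetric_convex_body_def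
proof (intro conjI)
  let ?B = "{x. norm (f x) \<le> 1}"
  have B: "?B = f -` cball 0 1" by auto
  have bl: "bounded_linear f"
    using f(1) linear_conv_bounded_linear by blast
  have cont: "continuous_on S f" for S
    by (simp add: bl linear_continuous_on)
  show "convex ?B"
    unfolding B by (intro convex_linear_vimage f(1) convex_cball)
  obtain k where k: "k > 0" "\<And>x. k * norm x \<le> norm (f x)"
    using linear_inj_bounded_below[OF f] by blast
  have "norm x \<le> 1 / k" if "norm (f x) \<le> 1" for x
    using order_trans[OF k(2) that] k(1) by (simp add: field_simps)
  then have "bounded ?B"
    unfolding bounded_iff by blast
  moreover have "closed ?B"
    unfolding B by (intro closed_vimage cont closed_cball)
  ultimately show "compact ?B"
    by (simp add: compact_eq_bounded_closed)
  have "0 \<in> f -` ball 0 1"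
    by (simp add: linear_0[OF f(1)])
  moreover have "f -` ball 0 1 \<subseteq> interior ?B"
    by (intro interior_maximal open_vimage cont open_ball) auto
  ultimately show "interior ?B \<noteq> {}"
    by blast
  show "\<forall>x\<in>?B. - x \<in> ?B"
    by (simp add: linear_neg[OF f(1)])
qed

text \<open>The norm \<open>N\<close> is always the pullback of the norm of the space along
  \<open>f = inv T\<close>. A copy is thus encoded by one coordinate map, and inclusions of bodies
  become inequalities between norms of linear maps.\<close>

lemma isometric_copy_iff:
  "isometric_copy TYPE('x::real_normed_vector) B \<longleftrightarrow>
    (\<exists>f :: real ^ 'n \<Rightarrow> 'x. linear f \<and> bij f \<and> B = {y. norm (f y) \<le> 1})"
proof
  assume "isometric_copy TYPE('x) B"
  then obtain N T where NT: "{y. N y \<le> 1} = B" "linear T" "bij T" "\<forall>x :: 'x. N (T x) = norm x"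
    unfolding isometric_copy_def by (elim conjE exE)
  have "norm (inv T y) = N y" for y
    using NT(4)[rule_format, of "inv T y"] NT(3) by (simp add: bij_is_surj surj_f_inv_f)
  then show "\<exists>f :: real ^ 'n \<Rightarrow> 'x. linear f \<and> bij f \<and> B = {y. norm (f y) \<le> 1}"
    using linear_inv_if_bij[OF NT(2,3)] bij_imp_bij_inv[OF NT(3)] NT(1)
    by (intro exI[of _ "inv T"]) simp
next
  assume "\<exists>f :: real ^ 'n \<Rightarrow> 'x. linear f \<and> bij f \<and> B = {y. norm (f y) \<le> 1}"
  then obtain f :: "real ^ 'n \<Rightarrow> 'x" where f: "linear f" "bij f" and B: "B = {y. norm (f y) \<le> 1}"
    by blast
  have "f y = 0 \<longleftrightarrow> y = 0" for y
    using f linear_injective_0[OF f(1)] linear_0[OF f(1)] by (auto simp: bij_is_inj)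
  then have "is_norm (\<lambda>y. norm (f y))"
    by (simp add: is_norm_def linear_add[OF f(1)] linear_scale[OF f(1)] norm_triangle_ineq)
  moreover have "linear (inv f)" "bij (inv f)" "\<forall>x. norm (f (inv f x)) = norm x"
    using f by (auto simp: linear_inv_if_bij bij_imp_bij_inv bij_is_surj surj_f_inv_f)
  moreover have "symmetric_convex_body B"
    unfolding B using f by (intro symmetric_convex_body_pullback bij_is_inj)
  ultimately show "isometric_copy TYPE('x) B"
    unfolding isometric_copy_def B by (intro conjI exI[of _ "\<lambda>y. norm (f y)"] exI[of _ "inv f"] refl) simp_all
qed

lemma scaleR_image_pullback_ball:
  fixes f :: "'a::real_vector \<Rightarrow> 'b::real_normed_vector"
  assumes f: "linear f" and c: "c > 0"
  shows "(*\<^sub>R) c ` {y. norm (f y) \<le> 1} = {y. norm (f y) \<le> c}"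
proof (intro set_eqI iffI)
  fix y assume "y \<in> {y. norm (f y) \<le> c}"
  then have "y /\<^sub>R c \<in> {y. norm (f y) \<le> 1}"
    using c by (simp add: linear_scale[OF f] field_simps)
  moreover have "y = c *\<^sub>R (y /\<^sub>R c)" using c by simp
  ultimately show "y \<in> (*\<^sub>R) c ` {y. norm (f y) \<le> 1}" by blast
qed (use c in \<open>auto simp: linear_scale[OF f] mult_left_le\<close>)

text \<open>By homogeneity it suffices to test the inclusion at the multiple of \<open>y\<close> on
  which \<open>norm (f y)\<close> equals \<open>s\<close>.\<close>

lemma pullback_ball_subset_imp_norm_le:
  fixes f :: "'a::real_vector \<Rightarrow> 'b::real_normed_vector" and g :: "'a \<Rightarrow> 'c::real_normed_vector"
  assumes f: "linear f" "inj f" and g: "linear g" and s: "s > 0"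
    and sub: "{y. norm (f y) \<le> s} \<subseteq> {y. norm (g y) \<le> r}"
  shows "s * norm (g y) \<le> r * norm (f y)"
proof (cases "y = 0")
  case False
  then have pos: "norm (f y) > 0"
    using f linear_injective_0[OF f(1)] by auto
  have "norm (f ((s / norm (f y)) *\<^sub>R y)) \<le> s"
    using s pos by (simp add: linear_scale[OF f(1)])
  then have "norm (g ((s / norm (f y)) *\<^sub>R y)) \<le> r"
    using sub by blast
  then show ?thesis
    using s pos by (simp add: linear_scale[OF g] field_simps)
qed (simp add: linear_0 f g)

lemma powr_exponent_exists:
  fixes a d :: real
  assumes "1 \<le> a" "a \<le> d"
  obtains l where "l \<in> {0..1}" "a = d powr l"
proof (cases "d = 1")
  case True
  \<comment> \<open>Here \<open>a = 1\<close> as well, and every exponent would do.\<close>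
  then show thesis using assms that[of 0] by simp
next
  case False
  then have "ln d > 0" using assms by simp
  moreover have "0 \<le> ln a" "ln a \<le> ln d" using assms by simp_all
  ultimately show thesis
    using assms that[of "ln a / ln d"] by (simp add: powr_def)
qed

section \<open>The two directions of the equivalence\<close>

lemma intermediate_space_imp_sandwich:
  assumes dimE: "dim (UNIV :: 'e::real_normed_vector set) = CARD('n::finite)"
    and dimF: "dim (UNIV :: 'f::real_normed_vector set) = CARD('n)"
    and dimX: "dim (UNIV :: 'x::real_normed_vector set) = CARD('n)"
    and inter: "intermediate_space TYPE('e) TYPE('f) TYPE('x)"
  shows "\<exists>l\<in>{0..1}. \<exists>BE BF BX :: (real ^ 'n) set.
       isometric_copy TYPE('e) BE \<and> isometric_copy TYPE('f) BF \<and> isometric_copy TYPE('x) BX \<and>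
       banach_mazur TYPE('e) TYPE('x) = banach_mazur TYPE('e) TYPE('f) powr l \<and>
       BE \<subseteq> BF \<and> BF \<subseteq> (*\<^sub>R) (banach_mazur TYPE('e) TYPE('f)) ` BE \<and>
       lower_body (banach_mazur TYPE('e) TYPE('f)) l BE BF \<subseteq> BX \<and>
       BX \<subseteq> upper_body (banach_mazur TYPE('e) TYPE('f)) l BE BF"
proof -
  define d a b where dab: "d = banach_mazur TYPE('e) TYPE('f)"
    "a = banach_mazur TYPE('e) TYPE('x)" "b = banach_mazur TYPE('x) TYPE('f)"
  have ge1: "d \<ge> 1" "a \<ge> 1" "b \<ge> 1"
    unfolding dab using banach_mazur_ge_1 dimE dimF dimX by blast+
  have split: "d powr l * d powr (1 - l) = d" for l
    using ge1(1) by (simp flip: powr_add)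
  have d: "d = a * b"
    using inter by (simp add: intermediate_space_def dab)
  then have "a \<le> d" using ge1 by (simp add: mult_le_cancel_left1)
  then obtain l where l: "l \<in> {0..1}" "a = d powr l"
    using powr_exponent_exists ge1(2) by blast
  \<comment> \<open>Intermediacy \<open>d = a * b\<close> fixes the second factor once the first is
    written as \<open>d powr l\<close>.\<close>
  have b: "b = d powr (1 - l)"
  proof -
    have "a * b = a * d powr (1 - l)"
      using split[of l] d l(2) by metis
    then show ?thesis using ge1 by simp
  qed
  obtain p :: "real ^ 'n \<Rightarrow> 'e" where p: "linear p" "bij p"
    using obtain_coordinates[OF dimE] by blast
  obtain S :: "'e \<Rightarrow> 'x" where S: "linear S" "bij S" "\<And>x. norm (S x) \<le> norm x"
      "\<And>x. norm x \<le> a * norm (S x)"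
    using banach_mazur_attained[OF dimE dimX] unfolding dab by metis
  obtain T :: "'x \<Rightarrow> 'f" where T: "linear T" "bij T" "\<And>x. norm (T x) \<le> norm x"
      "\<And>x. norm x \<le> b * norm (T x)"
    using banach_mazur_attained[OF dimX dimF] unfolding dab by metis
  \<comment> \<open>All three norms now live on \<open>real ^ 'n\<close>, pulled back along
    \<open>p\<close> for \<open>'e\<close>, \<open>s\<close> for \<open>'x\<close> and
    \<open>t\<close> for \<open>'f\<close>.\<close>
  define s t where "s = S \<circ> p" and "t = T \<circ> s"
  have s: "linear s" "bij s" and t: "linear t" "bij t"
    unfolding s_def t_def using p S T by (auto intro!: linear_compose bij_comp)
  have le: "norm (s y) \<le> norm (p y)" "norm (t y) \<le> norm (s y)"
      "norm (p y) \<le> a * norm (s y)" "norm (s y) \<le> b * norm (t y)" for y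
    using S T by (auto simp: s_def t_def)
  let ?BE = "{y. norm (p y) \<le> 1}" and ?BF = "{y. norm (t y) \<le> 1}" and ?BX = "{y. norm (s y) \<le> 1}"
  have copies: "isometric_copy TYPE('e) ?BE" "isometric_copy TYPE('f) ?BF" "isometric_copy TYPE('x) ?BX"
    unfolding isometric_copy_iff using p s t by metis+
  have EF: "?BE \<subseteq> ?BF"
    using order_trans[OF order_trans[OF le(2) le(1)]] by blast
  have FE: "?BF \<subseteq> (*\<^sub>R) d ` ?BE"
  proof -
    \<comment> \<open>The lower constants of \<open>S\<close> and \<open>T\<close> multiply to
      \<open>a * b\<close>, which is exactly \<open>d\<close>.\<close>
    have pt: "norm (p y) \<le> d * norm (t y)" for y
      using order_trans[OF le(3) mult_left_mono[OF le(4), of a y]] ge1 d by (simp add: mult.assoc)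
    have "norm (p y) \<le> d" if "norm (t y) \<le> 1" for y
      using order_trans[OF pt mult_left_le[OF that, of d]] ge1 by simp
    then show ?thesis
      using ge1 p by (auto simp: scaleR_image_pullback_ball)
  qed
  have low: "lower_body d l ?BE ?BF \<subseteq> ?BX"
    unfolding lower_body_def
  \<comment> \<open>As the ball of \<open>s\<close> is convex, only the two generating sets need
    checking; the scaling factor is \<open>1 / b\<close>.\<close>
  proof (rule hull_minimal)
    have "norm (s y) \<le> 1" if "norm (t y) \<le> 1 / b" for y
      using order_trans[OF le(4)[of y], of 1] that ge1 by (simp add: field_simps)
    moreover have "norm (s y) \<le> 1" if "norm (p y) \<le> 1" for y
      using order_trans[OF le(1) that] .
    ultimately show "?BE \<union> (*\<^sub>R) (1 / d powr (1 - l)) ` ?BF \<subseteq> ?BX"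
      using ge1 t unfolding b[symmetric]
      by (auto simp: scaleR_image_pullback_ball)
    show "convex ?BX"
      using copies(3) by (simp add: isometric_copy_def symmetric_convex_body_def)
  qed
  have up: "?BX \<subseteq> upper_body d l ?BE ?BF"
  proof -
    have "norm (p y) \<le> a" if "norm (s y) \<le> 1" for y
      using order_trans[OF le(3) mult_left_le[OF that, of a]] ge1 by simp
    moreover have "norm (t y) \<le> 1" if "norm (s y) \<le> 1" for y
      using order_trans[OF le(2) that] .
    ultimately show ?thesis
      using ge1 p unfolding upper_body_def l(2)[symmetric]
      by (auto simp: scaleR_image_pullback_ball)
  qed
  show ?thesis
    unfolding dab[symmetric]
    by (intro bexI[OF _ l(1)] exI conjI; fact)
qed

text \<open>With the distance from \<open>'e\<close> to \<open>'x\<close> prescribed, it remains to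
  bound the one from \<open>'x\<close> to \<open>'f\<close> by \<open>d powr (1 - l)\<close>. The
  map \<open>t \<circ> inv s\<close> does so: the upper body makes it a contraction, the lower body
  controls its inverse.\<close>

lemma sandwich_imp_intermediate_space:
  assumes dimE: "dim (UNIV :: 'e::real_normed_vector set) = CARD('n::finite)"
    and dimF: "dim (UNIV :: 'f::real_normed_vector set) = CARD('n)"
    and dimX: "dim (UNIV :: 'x::real_normed_vector set) = CARD('n)"
    and copies: "isometric_copy TYPE('f) BF" "isometric_copy TYPE('x) (BX :: (real ^ 'n) set)"
    and dist: "banach_mazur TYPE('e) TYPE('x) = banach_mazur TYPE('e) TYPE('f) powr l"
    and lower: "lower_body (banach_mazur TYPE('e) TYPE('f)) l BE BF \<subseteq> BX"
    and upper: "BX \<subseteq> upper_body (banach_mazur TYPE('e) TYPE('f)) l BE BF"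
  shows "intermediate_space TYPE('e) TYPE('f) TYPE('x)"
proof -
  define d a b where dab: "d = banach_mazur TYPE('e) TYPE('f)"
    "a = banach_mazur TYPE('e) TYPE('x)" "b = banach_mazur TYPE('x) TYPE('f)"
  have ge1: "d \<ge> 1" "a \<ge> 1" "b \<ge> 1"
    unfolding dab using banach_mazur_ge_1 dimE dimF dimX by blast+
  have split: "d powr l * d powr (1 - l) = d" for l
    using ge1(1) by (simp flip: powr_add)
  have l: "a = d powr l" and low: "lower_body d l BE BF \<subseteq> BX" and up: "BX \<subseteq> upper_body d l BE BF"
    using dist lower upper unfolding dab .
  define c where "c = d powr (1 - l)"
  have c: "c > 0" using ge1 by (simp add: c_def)
  obtain t :: "real ^ 'n \<Rightarrow> 'f" where t: "linear t" "bij t" and BF: "BF = {y. norm (t y) \<le> 1}"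
    using copies(1) unfolding isometric_copy_iff by blast
  obtain s :: "real ^ 'n \<Rightarrow> 'x" where s: "linear s" "bij s" and BX: "BX = {y. norm (s y) \<le> 1}"
    using copies(2) unfolding isometric_copy_iff by blast
  have "BX \<subseteq> BF"
    using up by (auto simp: upper_body_def)
  then have ts: "norm (t y) \<le> norm (s y)" for y
    using pullback_ball_subset_imp_norm_le[of s t 1 1] s t by (simp add: BX BF bij_is_inj)
  \<comment> \<open>The scaled ball is one of the two generators of the convex hull.\<close>
  have "(*\<^sub>R) (1 / c) ` BF \<subseteq> BX"
    using subset_trans[OF hull_subset low[unfolded lower_body_def]] unfolding c_def by simp
  then have "{y. norm (t y) \<le> 1 / c} \<subseteq> {y. norm (s y) \<le> 1}"
    using c t by (simp add: BX BF scaleR_image_pullback_ball)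
  then have st: "norm (s y) \<le> c * norm (t y)" for y
    using pullback_ball_subset_imp_norm_le[of t s "1 / c" 1 y] s t c
    by (simp add: bij_is_inj field_simps)
  have "b \<le> 1 * c"
    unfolding dab(3)
  proof (rule banach_mazur_le[of "t \<circ> inv s"])
    have "s (inv s x) = x" for x
      using s(2) by (simp add: bij_is_surj surj_f_inv_f)
    then show "norm ((t \<circ> inv s) x) \<le> 1 * norm x" "norm x \<le> c * norm ((t \<circ> inv s) x)" for x
      using ts[of "inv s x"] st[of "inv s x"] by simp_all
  qed (use s t c in \<open>auto intro: linear_compose linear_inv_if_bij bij_comp bij_imp_bij_inv\<close>)
  then have "a * b \<le> a * c"
    using ge1(2) by (intro mult_left_mono) auto
  also have "a * c = d"
    unfolding l c_def by (rule split)
  finally have "a * b \<le> d" .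
  moreover have "d \<le> a * b"
    unfolding dab by (rule banach_mazur_triangle[OF dimE dimF dimX])
  ultimately show ?thesis
    by (simp add: intermediate_space_def dab)
qed

theorem theorem1:
  assumes "dim (UNIV :: 'e::real_normed_vector set) = CARD('n::finite)"
    and "dim (UNIV :: 'f::real_normed_vector set) = CARD('n)"
    and "dim (UNIV :: 'x::real_normed_vector set) = CARD('n)"
  shows "intermediate_space TYPE('e) TYPE('f) TYPE('x) \<longleftrightarrow>
    (\<exists>l\<in>{0..1}. \<exists>BE BF BX :: (real ^ 'n) set.
       isometric_copy TYPE('e) BE \<and> isometric_copy TYPE('f) BF \<and> isometric_copy TYPE('x) BX \<and>
       banach_mazur TYPE('e) TYPE('x) = banach_mazur TYPE('e) TYPE('f) powr l \<and>
       BE \<subseteq> BF \<and> BF \<subseteq> (*\<^sub>R) (banach_mazur TYPE('e) TYPE('f)) ` BE \<and>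
       lower_body (banach_mazur TYPE('e) TYPE('f)) l BE BF \<subseteq> BX \<and>
       BX \<subseteq> upper_body (banach_mazur TYPE('e) TYPE('f)) l BE BF)"
  using intermediate_space_imp_sandwich[OF assms] sandwich_imp_intermediate_space[OF assms] by blast

end
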